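(* Let $n_1,n_2,n_3\in\mathbb{N}_0$, $n=n_1+n_2+n_3$, let $\alpha,\beta,\gamma,\delta,a,b$ be real parameters, and let $u=P_{n_1,n_2,n_3}^{(\alpha,\beta,\gamma,\delta,a,b)}(x,y,z)$ be the six-parameter polynomial in the context. Then on $\mathbb{T}^3$ the function $u$ satisfies the following four second order partial differential equations (subscripts on $u$ denote partial derivatives). (1) $$\begin{aligned}&x(1-x)u_{xx}+y(1-y)u_{yy}+z(1-z)u_{zz}-2xz\,u_{xz}-2yz\,u_{yz}-2xy\,u_{xy}\\&+\left(\alpha+1-(\alpha+\beta+\gamma+\delta+a+b+4)x\right)u_x+\left(\beta+1-(\alpha+\beta+\gamma+\delta+4)y+\frac{(a+b)xy-by}{1-x}\right)u_y\\&+\left(\gamma+1-(\alpha+\beta+\gamma+\delta+4)z+\frac{(a+b)xz}{1-x}+\frac{byz}{(1-x)(1-x-y)}\right)u_z\\&+\left(n(n+\alpha+\beta+\gamma+\delta+a+b+3)-\frac{a(n_2+n_3)}{1-x}-\frac{n_3b}{1-x-y}\right)u=0;\end{aligned}$$ (2) $$\begin{aligned}&y(1-x-y)u_{yy}-2yz\,u_{yz}+\frac{yz^2}{1-x-y}u_{zz}+\left((\beta+1)(1-x-y)-(\gamma+\delta+b+2)y\right)u_y\\&+\frac{1}{1-x-y}\left((\gamma+\delta+b+2)yz-(\beta+1)z(1-x-y)\right)u_z\\&+\left((\beta+1)n_3+n_2(n_2+2n_3+\beta+\gamma+\delta+b+2)-\frac{n_3(\gamma+\delta+b+n_3+1)y}{1-x-y}\right)u=0;\end{aligned}$$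 (3) $$z(1-x-y-z)u_{zz}+\left[(\gamma+1)(1-x-y-z)-(\delta+1)z\right]u_z+n_3(n_3+\gamma+\delta+1)u=0;$$ (4) $$\begin{aligned}&x(1-x)u_{xx}+\frac{xy^2}{1-x}u_{yy}+\frac{xz^2}{1-x}u_{zz}-2xy\,u_{xy}-2xz\,u_{xz}+\frac{2xyz}{1-x}u_{yz}\\&+\left(\alpha+1-(\alpha+\beta+\gamma+\delta+a+b+4)x\right)u_x-\frac{y}{1-x}\left(\alpha+1-(\alpha+\beta+\gamma+\delta+a+b+4)x\right)u_y\\&-\frac{z}{1-x}\left(\alpha+1-(\alpha+\beta+\gamma+\delta+a+b+4)x\right)u_z\\&+\left(n(n+\alpha+\beta+\gamma+\delta+a+b+3)-\frac{(n_2+n_3)(n_2+n_3+\beta+\gamma+\delta+a+b+2)}{1-x}\right)u=0.\end{aligned}$$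
   Context: Jacobi polynomials: for $n\in\mathbb{N}_0=\{0,1,2,\dots\}$ and real $p,q$, $$P_n^{(p,q)}(t)=\frac{(-1)^n}{2^n n!}(1-t)^{-p}(1+t)^{-q}\frac{d^n}{dt^n}\left\{(1-t)^{n+p}(1+t)^{n+q}\right\}$$ (a polynomial in $t$). The simplex is $\mathbb{T}^3=\{(x,y,z)\in\mathbb{R}^3: x,y,z>0,\ 1-x-y-z>0\}$. Six-parameter polynomials: for $n_1,n_2,n_3\in\mathbb{N}_0$, $$P_{n_1,n_2,n_3}^{(\alpha,\beta,\gamma,\delta,a,b)}(x,y,z)=P_{n_1}^{(\beta+\gamma+\delta+a+b+2n_2+2n_3+2,\,\alpha)}(2x-1)\,(1-x)^{n_2}\,P_{n_2}^{(\gamma+\delta+2n_3+b+1,\,\beta)}\!\left(\tfrac{2y}{1-x}-1\right)(1-x-y)^{n_3}\,P_{n_3}^{(\delta,\gamma)}\!\left(\tfrac{2z}{1-x-y}-1\right).$$ *)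

theory Defs
  imports "HOL-Analysis.Analysis"
begin

text \<open>
  Rodrigues' formula. With real exponents it describes the Jacobi polynomial only for
  \<open>-1 < t < 1\<close>; all arguments occurring in the six-parameter polynomials below lie in this
  interval when \<open>(x, y, z)\<close> lies in the open simplex.
\<close>

definition jacobi :: "nat \<Rightarrow> real \<Rightarrow> real \<Rightarrow> real \<Rightarrow> real" where
  "jacobi n p q t =
     (-1) ^ n / (2 ^ n * fact n) * (1 - t) powr (- p) * (1 + t) powr (- q) *
     (deriv ^^ n) (\<lambda>s. (1 - s) powr (real n + p) * (1 + s) powr (real n + q)) t"

definition simplex3 :: "(real \<times> real \<times> real) set" where
  "simplex3 = {(x, y, z). x > 0 \<and> y > 0 \<and> z > 0 \<and> 1 - x - y - z > 0}"

definition simplex_jacobi ::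
  "nat \<Rightarrow> nat \<Rightarrow> nat \<Rightarrow> real \<Rightarrow> real \<Rightarrow> real \<Rightarrow> real \<Rightarrow> real \<Rightarrow> real \<Rightarrow> real \<Rightarrow> real \<Rightarrow> real \<Rightarrow> real" where
  "simplex_jacobi n1 n2 n3 \<alpha> \<beta> \<gamma> \<delta> a b x y z =
     jacobi n1 (\<beta> + \<gamma> + \<delta> + a + b + 2 * real n2 + 2 * real n3 + 2) \<alpha> (2 * x - 1) *
     (1 - x) ^ n2 *
     jacobi n2 (\<gamma> + \<delta> + 2 * real n3 + b + 1) \<beta> (2 * y / (1 - x) - 1) *
     (1 - x - y) ^ n3 *
     jacobi n3 \<delta> \<gamma> (2 * z / (1 - x - y) - 1)"

definition dx :: "(real \<Rightarrow> real \<Rightarrow> real \<Rightarrow> real) \<Rightarrow> real \<Rightarrow> real \<Rightarrow> real \<Rightarrow> real" where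
  "dx u x y z = deriv (\<lambda>s. u s y z) x"

definition dy :: "(real \<Rightarrow> real \<Rightarrow> real \<Rightarrow> real) \<Rightarrow> real \<Rightarrow> real \<Rightarrow> real \<Rightarrow> real" where
  "dy u x y z = deriv (\<lambda>s. u x s z) y"

definition dz :: "(real \<Rightarrow> real \<Rightarrow> real \<Rightarrow> real) \<Rightarrow> real \<Rightarrow> real \<Rightarrow> real \<Rightarrow> real" where
  "dz u x y z = deriv (\<lambda>s. u x y s) z"

text \<open>
  Since \<open>deriv\<close> is total, the existence of the partial derivatives has to be asserted
  separately for the differential equations to be meaningful.
\<close>

definition has_partials_on ::
  "(real \<Rightarrow> real \<Rightarrow> real \<Rightarrow> real) \<Rightarrow> (real \<times> real \<times> real) set \<Rightarrow> bool" where
  "has_partials_on u S \<longleftrightarrow> (\<forall>(x, y, z) \<in> S.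
     (\<lambda>s. u s y z) differentiable at x \<and>
     (\<lambda>s. u x s z) differentiable at y \<and>
     (\<lambda>s. u x y s) differentiable at z)"

definition has_second_partials_on ::
  "(real \<Rightarrow> real \<Rightarrow> real \<Rightarrow> real) \<Rightarrow> (real \<times> real \<times> real) set \<Rightarrow> bool" where
  "has_second_partials_on u S \<longleftrightarrow>
     has_partials_on u S \<and> has_partials_on (dx u) S \<and>
     has_partials_on (dy u) S \<and> has_partials_on (dz u) S"

end

theory Submission
  imports Defs "HOL-Computational_Algebra.Polynomial"
begin

text \<open>
  In the variables \<open>x\<close>, \<open>s = y / (1 - x)\<close>, \<open>r = z / (1 - x - y)\<close> the simplex becomes a cube and
  \<open>u\<close> becomes a product \<open>f x * g s * h r\<close> of polynomials in one variable. This is so because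
  \<open>1 - x - y = (1 - x) * (1 - s)\<close>, so that \<open>(1 - x) ^ n2 * (1 - x - y) ^ n3\<close> splits into
  \<open>(1 - x) ^ (n2 + n3)\<close>, which goes into \<open>f\<close>, and \<open>(1 - s) ^ n3\<close>, which goes into \<open>g\<close>
  (\<open>simplex_jacobi_separated\<close>). Multiplying a solution of the Jacobi equation by a power of
  \<open>1 - t\<close> lowers the first parameter and adds a potential with a pole at \<open>t = 1\<close>
  (\<open>jacobi_ode_times_power\<close>); hence \<open>f\<close>, \<open>g\<close> and \<open>h\<close> all satisfy equations of one type,
  \<open>jacobi_ode\<close>.

  Three of the four partial differential equations are these ordinary ones, rewritten in the
  coordinates \<open>x, y, z\<close>. In the order of the theorem, the third is the equation of \<open>h\<close> along
  \<open>\<partial>\<^sub>z\<close>. The second is that of \<open>g\<close> along \<open>\<partial>\<^sub>y - z / (1 - x - y) * \<partial>\<^sub>z\<close>, a field that kills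
  \<open>x\<close> and \<open>r\<close>. The fourth is that of \<open>f\<close> along
  \<open>\<partial>\<^sub>x - y / (1 - x) * \<partial>\<^sub>y - z / (1 - x) * \<partial>\<^sub>z\<close>, a field that kills \<open>s\<close> and \<open>r\<close>. The
  coefficients of each field are constant along the field, so its square has no first order part
  and the second order terms can be read off. The first equation is the fourth plus the second
  divided by \<open>1 - x\<close> plus the third divided by \<open>1 - x - y\<close>.

  It remains to know that Rodrigues' formula gives a polynomial that solves the Jacobi equation
  for arbitrary real parameters. Each derivative of the weight is the weight with
  lowered exponents times a polynomial, and differentiating such a polynomial undoes one step of
  the recursion up to a constant (\<open>pderiv_rodrigues_poly\<close>). The Jacobi equation is this
  statement written out.
\<close>

section \<open>Rodrigues' formula and the Jacobi equation\<close>

text \<open>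
  These are the numerators left when powers of \<open>1 - t\<close> and \<open>1 + t\<close> are taken out of
  the derivatives of the weight: a derivative of \<open>(1 - t) ^ (r - k) * (1 + t) ^ (s - k) * Q\<close>
  costs one power of each factor, and the linear polynomial below is
  \<open>(s - k) * (1 - t) - (r - k) * (1 + t)\<close>.
\<close>

fun rodrigues_poly :: "real \<Rightarrow> real \<Rightarrow> nat \<Rightarrow> real poly" where
  "rodrigues_poly r s 0 = 1"
| "rodrigues_poly r s (Suc k) =
     [:1, 0, -1:] * pderiv (rodrigues_poly r s k)
     + [:s - r, - (r + s - 2 * real k):] * rodrigues_poly r s k"

lemma deriv_weight:
  assumes "-1 < t" "t < (1::real)"
  shows "(deriv ^^ k) (\<lambda>t. (1 - t) powr r * (1 + t) powr s) t =
     (1 - t) powr (r - real k) * (1 + t) powr (s - real k) * poly (rodrigues_poly r s k) t"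
  using assms
proof (induction k arbitrary: t)
  case 0
  then show ?case by simp
next
  case (Suc k)
  let ?Q = "rodrigues_poly r s k"
  \<comment> \<open>The induction hypothesis may be differentiated because it holds near \<open>t\<close>.\<close>
  have ev: "\<forall>\<^sub>F v in nhds t. (deriv ^^ k) (\<lambda>t. (1 - t) powr r * (1 + t) powr s) v =
      (1 - v) powr (r - real k) * (1 + v) powr (s - real k) * poly ?Q v"
    using eventually_nhds_in_open[of "{-1<..<1}" t] Suc.prems
    by (auto elim!: eventually_mono simp: Suc.IH)
  have pos: "1 - t > 0" "1 + t > 0" using Suc.prems by auto
  have r: "(1 - t) powr (r - real k) = (1 - t) powr (r - real (Suc k)) * (1 - t)"
    using powr_add[of "1 - t" "r - real (Suc k)" 1] pos by simp
  have s: "(1 + t) powr (s - real k) = (1 + t) powr (s - real (Suc k)) * (1 + t)"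
    using powr_add[of "1 + t" "s - real (Suc k)" 1] pos by simp
  have dr: "((\<lambda>v. (1 - v) powr (r - real k)) has_real_derivative
       - (r - real k) * (1 - t) powr (r - real (Suc k))) (at t)"
    using pos by (auto intro!: derivative_eq_intros simp: algebra_simps)
  have ds: "((\<lambda>v. (1 + v) powr (s - real k)) has_real_derivative
       (s - real k) * (1 + t) powr (s - real (Suc k))) (at t)"
    using pos by (auto intro!: derivative_eq_intros simp: algebra_simps)
  have "((\<lambda>v. (1 - v) powr (r - real k) * (1 + v) powr (s - real k) * poly ?Q v)
     has_real_derivative (1 - t) powr (r - real (Suc k)) * (1 + t) powr (s - real (Suc k))
        * poly (rodrigues_poly r s (Suc k)) t) (at t)"
    by (rule DERIV_cong[OF DERIV_mult[OF DERIV_mult[OF dr ds] poly_DERIV]])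
      (simp only: r s, simp add: algebra_simps)
  then show ?case
    using deriv_cong_ev[OF ev refl] by (simp add: DERIV_imp_deriv)
qed

lemma pderiv_rodrigues_poly_Suc:
  fixes r s :: real
  defines "Q \<equiv> rodrigues_poly r s"
  shows "poly (pderiv (Q (Suc k))) t =
     (1 - t\<^sup>2) * poly (pderiv (pderiv (Q k))) t
     + (s - r - (r + s - 2 * real k + 2) * t) * poly (pderiv (Q k)) t
     - (r + s - 2 * real k) * poly (Q k) t"
  unfolding Q_def
  by (simp add: pderiv_mult pderiv_add pderiv_smult pderiv_minus pderiv_pCons
      power2_eq_square algebra_simps)

text \<open>
  Write \<open>Q\<close>, \<open>R\<close> for the polynomials of index \<open>k\<close>, \<open>k + 1\<close> and \<open>\<lambda>\<close> for the linear coefficient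
  in the recursion. If \<open>R' = - \<nu> Q\<close>, then multiplying the recursion for \<open>R\<close> by \<open>- \<nu>\<close> gives
  \<open>(1 - t\<^sup>2) R'' + \<lambda> R' = - \<nu> R\<close>. In the derivative of the next polynomial the term \<open>- 2 t R'\<close>
  that comes from \<open>1 - t\<^sup>2\<close> cancels the increase of \<open>\<lambda>\<close> by \<open>2 t\<close>, and only multiples of \<open>R\<close>
  are left.
\<close>

lemma pderiv_rodrigues_poly:
  "poly (pderiv (rodrigues_poly r s (Suc k))) t =
     - (real (Suc k) * (r + s - real k)) * poly (rodrigues_poly r s k) t"
proof (induction k arbitrary: t)
  case 0
  show ?case by (simp add: pderiv_pCons one_pCons)
next
  case (Suc k)
  let ?Q = "rodrigues_poly r s k" and ?R = "rodrigues_poly r s (Suc k)"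
  define \<nu> where "\<nu> = real (Suc k) * (r + s - real k)"
  have R': "pderiv ?R = smult (- \<nu>) ?Q"
    using Suc unfolding \<nu>_def by (intro poly_ext) (simp only: poly_smult)
  have "(1 - t\<^sup>2) * poly (pderiv (pderiv ?R)) t
      + (s - r - (r + s - 2 * real k) * t) * poly (pderiv ?R) t = - \<nu> * poly ?R t"
    unfolding R' by (simp add: pderiv_smult pderiv_minus power2_eq_square algebra_simps)
  then show ?case
    unfolding pderiv_rodrigues_poly_Suc[of r s "Suc k"] \<nu>_def
    by (simp add: algebra_simps del: rodrigues_poly.simps)
qed

text \<open>
  The hypergeometric equation on the unit interval whose polynomial solutions are the Jacobi
  polynomials in \<open>2 * t - 1\<close>, with an additional potential \<open>d * t / (1 - t)\<close>. The potential
  vanishes for Jacobi polynomials; it makes the class stable under multiplication by \<open>1 - t\<close>.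
\<close>

definition jacobi_ode :: "real \<Rightarrow> real \<Rightarrow> real \<Rightarrow> real \<Rightarrow> real poly \<Rightarrow> bool" where
  "jacobi_ode p q c d f \<longleftrightarrow> (\<forall>t. 0 < t \<and> t < 1 \<longrightarrow>
     t * (1 - t) * poly (pderiv (pderiv f)) t + (q + 1 - (p + q + 2) * t) * poly (pderiv f) t
     + (c - d * t / (1 - t)) * poly f t = 0)"

lemma jacobi_shifted_polynomial:
  obtains P where
    "\<And>t. 0 < t \<Longrightarrow> t < 1 \<Longrightarrow> jacobi n p q (2 * t - 1) = poly P t"
    "jacobi_ode p q (real n * (real n + p + q + 1)) 0 P"
proof
  define r s where "r = real n + p" and "s = real n + q"
  define Q where "Q = rodrigues_poly r s n"
  define P where "P = smult ((-1) ^ n / (2 ^ n * fact n)) (pcompose Q [:-1, 2:])"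
  show "jacobi n p q (2 * t - 1) = poly P t" if "0 < t" "t < 1" for t
  proof -
    let ?T = "2 * t - 1"
    have T: "-1 < ?T" "?T < 1" using that by auto
    have "(1 - ?T) powr (- p) * (1 - ?T) powr p = 1" "(1 + ?T) powr (- q) * (1 + ?T) powr q = 1"
      using T by (simp_all flip: powr_add)
    moreover have "jacobi n p q ?T = (-1) ^ n / (2 ^ n * fact n)
        * (((1 - ?T) powr (- p) * (1 - ?T) powr p) * ((1 + ?T) powr (- q) * (1 + ?T) powr q)
        * poly Q ?T)"
      using deriv_weight[OF T, of n r s] unfolding jacobi_def r_def s_def Q_def
      by (simp only: add_diff_cancel_left' mult_ac)
    moreover have "poly P t = (-1) ^ n / (2 ^ n * fact n) * poly Q ?T"
      by (simp add: P_def poly_pcompose algebra_simps)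
    ultimately show ?thesis by (simp only: mult_1)
  qed
  \<comment> \<open>For \<open>k = n\<close> the exponents left over are \<open>r - n = p\<close> and \<open>s - n = q\<close>.\<close>
  have ode: "(1 - T\<^sup>2) * poly (pderiv (pderiv Q)) T + (q - p - (p + q + 2) * T) * poly (pderiv Q) T
      + real n * (real n + p + q + 1) * poly Q T = 0" for T
    using pderiv_rodrigues_poly[of r s n T] unfolding pderiv_rodrigues_poly_Suc Q_def[symmetric]
    by (simp add: r_def s_def algebra_simps)
  have "t * (1 - t) * poly (pderiv (pderiv P)) t
      + (q + 1 - (p + q + 2) * t) * poly (pderiv P) t
      + real n * (real n + p + q + 1) * poly P t = 0" for t
  proof -
    define c :: real where "c = (-1) ^ n / (2 ^ n * fact n)"
    have P: "poly P t = c * poly Q (2 * t - 1)"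
      "poly (pderiv P) t = 2 * c * poly (pderiv Q) (2 * t - 1)"
      "poly (pderiv (pderiv P)) t = 4 * c * poly (pderiv (pderiv Q)) (2 * t - 1)"
      by (simp_all add: P_def c_def pderiv_smult pderiv_pcompose pderiv_mult pderiv_pCons
          poly_pcompose algebra_simps)
    have "c * ((1 - (2*t-1)\<^sup>2) * poly (pderiv (pderiv Q)) (2*t-1)
       + (q - p - (p + q + 2) * (2*t-1)) * poly (pderiv Q) (2*t-1)
       + real n * (real n + p + q + 1) * poly Q (2*t-1)) = 0"
      using ode by simp
    then show ?thesis unfolding P by (simp add: power2_eq_square algebra_simps)
  qed
  then show "jacobi_ode p q (real n * (real n + p + q + 1)) 0 P"
    by (simp add: jacobi_ode_def)
qed

text \<open>
  One factor \<open>1 - t\<close> lowers \<open>p\<close> by two: in the equation for \<open>(1 - t) * F\<close> the cross term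
  \<open>- 2 * t * (1 - t) * F'\<close> of the product rule adds \<open>- 2 * t\<close> to the coefficient of \<open>F'\<close>, so
  that \<open>F\<close> satisfies the equation with \<open>p + 2\<close>. The remaining terms add \<open>q + 1\<close> to \<open>c\<close> and \<open>p + 1\<close> to \<open>d\<close>; summed over the \<open>N\<close> factors,
  with \<open>p\<close> changing at each, the latter give \<open>N * (N + p)\<close>.
\<close>

lemma jacobi_ode_times_power:
  assumes "jacobi_ode (p + 2 * real N) q c 0 f"
  shows "jacobi_ode p q (c + real N * (q + 1)) (real N * (real N + p)) ([:1, -1:] ^ N * f)"
  using assms
proof (induction N arbitrary: p)
  case 0
  then show ?case by simp
next
  case (Suc N)
  define F where "F = [:1, -1:] ^ N * f"
  define C where "C = c + real N * (q + 1)"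
  define D where "D = real N * (real N + (p + 2))"
  have "jacobi_ode (p + 2) q C D F"
    unfolding F_def C_def D_def using Suc.prems by (intro Suc.IH) (simp add: algebra_simps)
  then have F: "t * (1 - t) * poly (pderiv (pderiv F)) t
      + (q + 1 - (p + q + 4) * t) * poly (pderiv F) t + (C - D * t / (1 - t)) * poly F t = 0"
    if "0 < t" "t < 1" for t
    using that by (simp add: jacobi_ode_def add_ac)
  have "jacobi_ode p q (C + (q + 1)) (D + (p + 1)) ([:1, -1:] * F)"
    unfolding jacobi_ode_def
  proof (intro allI impI, elim conjE)
    fix t :: real assume t: "0 < t" "t < 1"
    have G: "poly ([:1, -1:] * F) t = (1 - t) * poly F t"
      "poly (pderiv ([:1, -1:] * F)) t = (1 - t) * poly (pderiv F) t - poly F t"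
      "poly (pderiv (pderiv ([:1, -1:] * F))) t =
         (1 - t) * poly (pderiv (pderiv F)) t - 2 * poly (pderiv F) t"
      by (simp_all add: pderiv_mult pderiv_add pderiv_diff pderiv_minus pderiv_pCons algebra_simps)
    show "t * (1 - t) * poly (pderiv (pderiv ([:1, -1:] * F))) t
        + (q + 1 - (p + q + 2) * t) * poly (pderiv ([:1, -1:] * F)) t
        + (C + (q + 1) - (D + (p + 1)) * t / (1 - t)) * poly ([:1, -1:] * F) t = 0"
      (is "?L = 0")
    proof -
      have "?L = (1 - t) * (t * (1 - t) * poly (pderiv (pderiv F)) t
      + (q + 1 - (p + q + 4) * t) * poly (pderiv F) t + (C - D * t / (1 - t)) * poly F t)"
        unfolding G using t by (simp add: divide_simps) (simp add: algebra_simps)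
      then show ?thesis using F[OF t] by simp
    qed
  qed
  moreover have "C + (q + 1) = c + real (Suc N) * (q + 1)"
    "D + (p + 1) = real (Suc N) * (real (Suc N) + p)"
    "[:1, -1:] * F = [:1, -1:] ^ Suc N * f"
    unfolding C_def D_def F_def by (simp_all add: algebra_simps)
  ultimately show ?case by simp
qed

section \<open>Partial derivatives on the simplex\<close>

definition has_gradient_on_simplex ::
  "(real \<Rightarrow> real \<Rightarrow> real \<Rightarrow> real) \<Rightarrow> (real \<Rightarrow> real \<Rightarrow> real \<Rightarrow> real) \<Rightarrow>
   (real \<Rightarrow> real \<Rightarrow> real \<Rightarrow> real) \<Rightarrow> (real \<Rightarrow> real \<Rightarrow> real \<Rightarrow> real) \<Rightarrow> bool" where
  "has_gradient_on_simplex v vx vy vz \<longleftrightarrow> (\<forall>x y z. (x, y, z) \<in> simplex3 \<longrightarrow>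
     ((\<lambda>s. v s y z) has_real_derivative vx x y z) (at x) \<and>
     ((\<lambda>s. v x s z) has_real_derivative vy x y z) (at y) \<and>
     ((\<lambda>s. v x y s) has_real_derivative vz x y z) (at z))"

text \<open>
  The simplex is open, so a derivative at one of its points depends only on values inside it.
  This is what allows a partial derivative that is known only on the simplex to be differentiated
  once more.
\<close>

lemma has_gradient_on_simplex_cong:
  assumes grad: "has_gradient_on_simplex v vx vy vz"
    and eq: "\<And>x y z. (x, y, z) \<in> simplex3 \<Longrightarrow> u x y z = v x y z"
    and eq_grad: "\<And>x y z. (x, y, z) \<in> simplex3 \<Longrightarrow> vx x y z = ux x y z"
      "\<And>x y z. (x, y, z) \<in> simplex3 \<Longrightarrow> vy x y z = uy x y z"
      "\<And>x y z. (x, y, z) \<in> simplex3 \<Longrightarrow> vz x y z = uz x y z"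
  shows "has_gradient_on_simplex u ux uy uz"
  unfolding has_gradient_on_simplex_def
proof (intro allI impI conjI)
  fix x y z assume S: "(x, y, z) \<in> simplex3"
  then have pos: "x > 0" "y > 0" "z > 0" "1 - x - y - z > 0" by (auto simp: simplex3_def)
  have v: "((\<lambda>s. v s y z) has_real_derivative ux x y z) (at x)"
    "((\<lambda>s. v x s z) has_real_derivative uy x y z) (at y)"
    "((\<lambda>s. v x y s) has_real_derivative uz x y z) (at z)"
    using grad S eq_grad by (auto simp: has_gradient_on_simplex_def)
  show "((\<lambda>s. u s y z) has_real_derivative ux x y z) (at x)"
    by (rule has_field_derivative_transform_within_open[OF v(1), of "{0<..<1 - y - z}"])
    (use pos in \<open>auto intro!: eq[symmetric] simp: simplex3_def\<close>)
  show "((\<lambda>s. u x s z) has_real_derivative uy x y z) (at y)"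
    by (rule has_field_derivative_transform_within_open[OF v(2), of "{0<..<1 - x - z}"])
    (use pos in \<open>auto intro!: eq[symmetric] simp: simplex3_def\<close>)
  show "((\<lambda>s. u x y s) has_real_derivative uz x y z) (at z)"
    by (rule has_field_derivative_transform_within_open[OF v(3), of "{0<..<1 - x - y}"])
    (use pos in \<open>auto intro!: eq[symmetric] simp: simplex3_def\<close>)
qed

lemma has_gradient_on_simplexD:
  assumes "has_gradient_on_simplex v vx vy vz"
  shows "has_partials_on v simplex3"
    and "(x, y, z) \<in> simplex3 \<Longrightarrow> dx v x y z = vx x y z"
    and "(x, y, z) \<in> simplex3 \<Longrightarrow> dy v x y z = vy x y z"
    and "(x, y, z) \<in> simplex3 \<Longrightarrow> dz v x y z = vz x y z"
  using assms
  by (auto simp: has_gradient_on_simplex_def has_partials_on_def dx_def dy_def dz_def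
      real_differentiable_def intro: DERIV_imp_deriv)

lemma has_gradient_on_simplex_add:
  assumes "has_gradient_on_simplex v vx vy vz" "has_gradient_on_simplex w wx wy wz"
  shows "has_gradient_on_simplex (\<lambda>x y z. v x y z + w x y z) (\<lambda>x y z. vx x y z + wx x y z)
    (\<lambda>x y z. vy x y z + wy x y z) (\<lambda>x y z. vz x y z + wz x y z)"
  using assms by (auto simp: has_gradient_on_simplex_def intro!: DERIV_add)

text \<open>
  The chain rule for the coordinates \<open>s = y / m\<close> and \<open>r = z / w\<close>, whose derivatives are
  \<open>\<partial>\<^sub>x s = s / m\<close>, \<open>\<partial>\<^sub>y s = 1 / m\<close>, \<open>\<partial>\<^sub>x r = \<partial>\<^sub>y r = r / w\<close> and
  \<open>\<partial>\<^sub>z r = 1 / w\<close>. The factors are arbitrary functions rather than polynomials, because the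
  first derivatives of a product of polynomials are sums of products with denominators \<open>1 - t\<close>.
\<close>

lemma has_gradient_on_simplex_product:
  assumes \<phi>: "\<forall>t\<in>{0<..<1}. (\<phi> has_real_derivative \<phi>' t) (at t)"
    and \<psi>: "\<forall>t\<in>{0<..<1}. (\<psi> has_real_derivative \<psi>' t) (at t)"
    and \<eta>: "\<forall>t\<in>{0<..<1}. (\<eta> has_real_derivative \<eta>' t) (at t)"
  shows "has_gradient_on_simplex
    (\<lambda>x y z. \<phi> x * \<psi> (y / (1 - x)) * \<eta> (z / (1 - x - y)))
    (\<lambda>x y z. let m = 1 - x; w = 1 - x - y; s = y / m; r = z / w in
       \<phi>' x * \<psi> s * \<eta> r + \<phi> x * (\<psi>' s * s / m) * \<eta> r + \<phi> x * \<psi> s * (\<eta>' r * r / w))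
    (\<lambda>x y z. let m = 1 - x; w = 1 - x - y; s = y / m; r = z / w in
       \<phi> x * (\<psi>' s / m) * \<eta> r + \<phi> x * \<psi> s * (\<eta>' r * r / w))
    (\<lambda>x y z. let m = 1 - x; w = 1 - x - y; s = y / m; r = z / w in
       \<phi> x * \<psi> s * (\<eta>' r / w))"
  unfolding has_gradient_on_simplex_def Let_def
proof (intro allI impI conjI)
  fix x y z :: real
  assume "(x, y, z) \<in> simplex3"
  then have pos: "x > 0" "y > 0" "z > 0" "1 - x > 0" "1 - x - y > 0" "1 - x - y - z > 0"
    by (auto simp: simplex3_def)
  define s r where "s = y / (1 - x)" and "r = z / (1 - x - y)"
  have s01: "s \<in> {0<..<1}" and r01: "r \<in> {0<..<1}" and x01: "x \<in> {0<..<1}"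
    using pos by (simp_all add: s_def r_def)
  note \<phi>x = bspec[OF \<phi> x01]
  have sx: "((\<lambda>x. y / (1 - x)) has_real_derivative s / (1 - x)) (at x)"
    using pos by (auto intro!: derivative_eq_intros simp: s_def)
  have sy: "((\<lambda>y. y / (1 - x)) has_real_derivative 1 / (1 - x)) (at y)"
    using pos by (auto intro!: derivative_eq_intros)
  have rx: "((\<lambda>x. z / (1 - x - y)) has_real_derivative r / (1 - x - y)) (at x)"
    and ry: "((\<lambda>y. z / (1 - x - y)) has_real_derivative r / (1 - x - y)) (at y)"
    and rz: "((\<lambda>z. z / (1 - x - y)) has_real_derivative 1 / (1 - x - y)) (at z)"
    using pos by (auto intro!: derivative_eq_intros simp: r_def)
  have \<psi>s: "((\<lambda>v. \<psi> (k v)) has_real_derivative \<psi>' s * D) (at v)"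
    if "(k has_real_derivative D) (at v)" "k v = s" for k D v
    using DERIV_chain2[of \<psi> _ k v] bspec[OF \<psi> s01] that by simp
  have \<eta>r: "((\<lambda>v. \<eta> (k v)) has_real_derivative \<eta>' r * D) (at v)"
    if "(k has_real_derivative D) (at v)" "k v = r" for k D v
    using DERIV_chain2[of \<eta> _ k v] bspec[OF \<eta> r01] that by simp
  show "((\<lambda>x. \<phi> x * \<psi> (y / (1 - x)) * \<eta> (z / (1 - x - y))) has_real_derivative
      \<phi>' x * \<psi> (y / (1 - x)) * \<eta> (z / (1 - x - y))
      + \<phi> x * (\<psi>' (y / (1 - x)) * (y / (1 - x)) / (1 - x)) * \<eta> (z / (1 - x - y))
      + \<phi> x * \<psi> (y / (1 - x))
          * (\<eta>' (z / (1 - x - y)) * (z / (1 - x - y)) / (1 - x - y))) (at x)"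
    by (rule DERIV_cong[OF DERIV_mult[OF DERIV_mult[OF \<phi>x \<psi>s[OF sx s_def[symmetric]]] \<eta>r[OF rx r_def[symmetric]]]])
      (simp only: s_def[symmetric] r_def[symmetric], simp add: algebra_simps)
  show "((\<lambda>y. \<phi> x * \<psi> (y / (1 - x)) * \<eta> (z / (1 - x - y))) has_real_derivative
      \<phi> x * (\<psi>' (y / (1 - x)) / (1 - x)) * \<eta> (z / (1 - x - y))
      + \<phi> x * \<psi> (y / (1 - x))
          * (\<eta>' (z / (1 - x - y)) * (z / (1 - x - y)) / (1 - x - y))) (at y)"
    by (rule DERIV_cong[OF DERIV_mult[OF DERIV_cmult[OF \<psi>s[OF sy s_def[symmetric]]] \<eta>r[OF ry r_def[symmetric]]]])
      (simp only: s_def[symmetric] r_def[symmetric], simp add: algebra_simps)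
  show "((\<lambda>z. \<phi> x * \<psi> (y / (1 - x)) * \<eta> (z / (1 - x - y))) has_real_derivative
      \<phi> x * \<psi> (y / (1 - x)) * (\<eta>' (z / (1 - x - y)) / (1 - x - y))) (at z)"
    by (rule DERIV_cong[OF DERIV_cmult[OF \<eta>r[OF rz r_def[symmetric]]]])
      (simp only: s_def[symmetric] r_def[symmetric], simp add: algebra_simps)
qed

text \<open>
  The coordinates \<open>m = 1 - x\<close>, \<open>n = 1 - s\<close> and \<open>r\<close> turn all denominators into monomials, so
  that rational identities on the simplex reduce to polynomial ones. The first four equations
  are oriented so that, applied as rewrite rules from the inside out, they eliminate every
  quotient.
\<close>

lemma simplex3_coordinates:
  assumes "(x, y, z) \<in> simplex3"
  obtains m n r where "0 < m" "0 < n" "n < 1" "0 < r" "r < 1"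
    "1 - x = m" "m - y = m * n" "y / m = 1 - n" "z / (m * n) = r"
    "x = 1 - m" "y = m * (1 - n)" "z = m * n * r"
proof
  have pos: "0 < y" "0 < z" "0 < 1 - x" "0 < 1 - x - y" "z < 1 - x - y"
    using assms by (auto simp: simplex3_def)
  have "(1 - x) * (1 - y / (1 - x)) = 1 - x - y" using pos by (simp add: field_simps)
  with pos show "0 < 1 - x" "0 < 1 - y / (1 - x)" "1 - y / (1 - x) < 1"
    "0 < z / (1 - x - y)" "z / (1 - x - y) < 1"
    "1 - x = 1 - x" "1 - x - y = (1 - x) * (1 - y / (1 - x))"
    "y / (1 - x) = 1 - (1 - y / (1 - x))"
    "z / ((1 - x) * (1 - y / (1 - x))) = z / (1 - x - y)"
    "x = 1 - (1 - x)" "y = (1 - x) * (1 - (1 - y / (1 - x)))"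
    "z = (1 - x) * (1 - y / (1 - x)) * (z / (1 - x - y))"
    by simp_all
qed

section \<open>Products in the separating coordinates\<close>

context
  fixes f g h :: "real poly"
begin

definition sep where
  "sep x y z = poly f x * poly g (y / (1 - x)) * poly h (z / (1 - x - y))"

text \<open>
  The partial derivatives, as polynomial expressions in the derivatives of the factors. The
  suffix lists the variables of differentiation; each mixed derivative serves for both orders.
\<close>

definition sep_x where
  "sep_x x y z = (let m = 1 - x; w = 1 - x - y; s = y / m; r = z / w in
     poly (pderiv f) x * poly g s * poly h r
     + poly f x * (poly (pderiv g) s * s / m) * poly h r
     + poly f x * poly g s * (poly (pderiv h) r * r / w))"

definition sep_y where
  "sep_y x y z = (let m = 1 - x; w = 1 - x - y; s = y / m; r = z / w in
     poly f x * (poly (pderiv g) s / m) * poly h r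
     + poly f x * poly g s * (poly (pderiv h) r * r / w))"

definition sep_z where
  "sep_z x y z = (let m = 1 - x; w = 1 - x - y; s = y / m; r = z / w in
     poly f x * poly g s * (poly (pderiv h) r / w))"

definition sep_xx where
  "sep_xx x y z = (let m = 1 - x; w = 1 - x - y; s = y / m; r = z / w in
     poly (pderiv (pderiv f)) x * poly g s * poly h r
     + 2 * poly (pderiv f) x * (poly (pderiv g) s * s / m) * poly h r
     + 2 * poly (pderiv f) x * poly g s * (poly (pderiv h) r * r / w)
     + poly f x * ((poly (pderiv (pderiv g)) s * s\<^sup>2 + 2 * poly (pderiv g) s * s) / m\<^sup>2) * poly h r
     + 2 * poly f x * (poly (pderiv g) s * s / m) * (poly (pderiv h) r * r / w)
     + poly f x * poly g s * ((poly (pderiv (pderiv h)) r * r\<^sup>2 + 2 * poly (pderiv h) r * r) / w\<^sup>2))"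

definition sep_xy where
  "sep_xy x y z = (let m = 1 - x; w = 1 - x - y; s = y / m; r = z / w in
     poly (pderiv f) x * (poly (pderiv g) s / m) * poly h r
     + poly (pderiv f) x * poly g s * (poly (pderiv h) r * r / w)
     + poly f x * ((poly (pderiv (pderiv g)) s * s + poly (pderiv g) s) / m\<^sup>2) * poly h r
     + poly f x * (poly (pderiv g) s * (s + 1) / m) * (poly (pderiv h) r * r / w)
     + poly f x * poly g s * ((poly (pderiv (pderiv h)) r * r\<^sup>2 + 2 * poly (pderiv h) r * r) / w\<^sup>2))"

definition sep_xz where
  "sep_xz x y z = (let m = 1 - x; w = 1 - x - y; s = y / m; r = z / w in
     poly (pderiv f) x * poly g s * (poly (pderiv h) r / w)
     + poly f x * (poly (pderiv g) s * s / m) * (poly (pderiv h) r / w)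
     + poly f x * poly g s * ((poly (pderiv (pderiv h)) r * r + poly (pderiv h) r) / w\<^sup>2))"

definition sep_yy where
  "sep_yy x y z = (let m = 1 - x; w = 1 - x - y; s = y / m; r = z / w in
     poly f x * (poly (pderiv (pderiv g)) s / m\<^sup>2) * poly h r
     + 2 * poly f x * (poly (pderiv g) s / m) * (poly (pderiv h) r * r / w)
     + poly f x * poly g s * ((poly (pderiv (pderiv h)) r * r\<^sup>2 + 2 * poly (pderiv h) r * r) / w\<^sup>2))"

definition sep_yz where
  "sep_yz x y z = (let m = 1 - x; w = 1 - x - y; s = y / m; r = z / w in
     poly f x * (poly (pderiv g) s / m) * (poly (pderiv h) r / w)
     + poly f x * poly g s * ((poly (pderiv (pderiv h)) r * r + poly (pderiv h) r) / w\<^sup>2))"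

definition sep_zz where
  "sep_zz x y z = (let m = 1 - x; w = 1 - x - y; s = y / m; r = z / w in
     poly f x * poly g s * (poly (pderiv (pderiv h)) r / w\<^sup>2))"

lemmas sep_defs = sep_def sep_x_def sep_y_def sep_z_def sep_xx_def sep_xy_def sep_xz_def
  sep_yy_def sep_yz_def sep_zz_def

text \<open>The one-variable factors that occur in the first derivatives of the product.\<close>

lemma has_derivative_poly_unit:
  "\<forall>t\<in>{0<..<1}. (poly k has_real_derivative poly (pderiv k) t) (at t)"
  "\<forall>t\<in>{0<..<1}. ((\<lambda>t. t * poly k t) has_real_derivative poly k t + t * poly (pderiv k) t) (at t)"
  "\<forall>t\<in>{0<..<1}. ((\<lambda>t. poly k t / (1 - t)) has_real_derivative
     poly (pderiv k) t / (1 - t) + poly k t / (1 - t)\<^sup>2) (at t)"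
  for k :: "real poly"
  by (auto intro!: derivative_eq_intros simp: divide_simps power2_eq_square)

lemma sep_gradient: "has_gradient_on_simplex sep sep_x sep_y sep_z"
  using has_gradient_on_simplex_product[OF has_derivative_poly_unit(1)
      has_derivative_poly_unit(1) has_derivative_poly_unit(1), of f g h]
  unfolding sep_def[abs_def] sep_x_def[abs_def] sep_y_def[abs_def] sep_z_def[abs_def] .

text \<open>
  Each first partial derivative is a sum of products of the same separated kind, because
  \<open>1 / (1 - x - y) = 1 / (1 - x) * (1 / (1 - s))\<close>. So the product rule applies a second time.
\<close>

lemma sep_second_gradients:
  "has_gradient_on_simplex sep_x sep_xx sep_xy sep_xz"
  "has_gradient_on_simplex sep_y sep_xy sep_yy sep_yz"
  "has_gradient_on_simplex sep_z sep_xz sep_yz sep_zz"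
proof -
  note id = has_derivative_poly_unit(1) and times = has_derivative_poly_unit(2)
    and over = has_derivative_poly_unit(3)
  note prod = has_gradient_on_simplex_product
  note add = has_gradient_on_simplex_add
  \<comment> \<open>The summands are named after the factor that is differentiated, with the coordinate that
     multiplies it.\<close>
  note f'gh = prod[OF id[of "pderiv f"] id[of g] id[of h]]
  note fg'h_s = prod[OF over[of f] times[of "pderiv g"] id[of h]]
  note fgh'_r = prod[OF over[of f] over[of g] times[of "pderiv h"]]
  note fg'h = prod[OF over[of f] id[of "pderiv g"] id[of h]]
  note fgh' = prod[OF over[of f] over[of g] id[of "pderiv h"]]
  show "has_gradient_on_simplex sep_x sep_xx sep_xy sep_xz"
    by (rule has_gradient_on_simplex_cong[OF add[OF add[OF f'gh fg'h_s] fgh'_r]];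
        erule simplex3_coordinates; simp only: sep_defs Let_def;
        simp add: field_simps power2_eq_square)
  show "has_gradient_on_simplex sep_y sep_xy sep_yy sep_yz"
    by (rule has_gradient_on_simplex_cong[OF add[OF fg'h fgh'_r]];
        erule simplex3_coordinates; simp only: sep_defs Let_def;
        simp add: field_simps power2_eq_square)
  show "has_gradient_on_simplex sep_z sep_xz sep_yz sep_zz"
    by (rule has_gradient_on_simplex_cong[OF fgh'];
        erule simplex3_coordinates; simp only: sep_defs Let_def;
        simp add: field_simps power2_eq_square)
qed

lemma sep_partials:
  assumes u: "\<forall>x y z. (x, y, z) \<in> simplex3 \<longrightarrow> u x y z = sep x y z"
  shows "has_second_partials_on u simplex3"
    and "(x, y, z) \<in> simplex3 \<Longrightarrow>
      dx u x y z = sep_x x y z \<and> dy u x y z = sep_y x y z \<and> dz u x y z = sep_z x y z \<and>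
      dx (dx u) x y z = sep_xx x y z \<and> dy (dx u) x y z = sep_xy x y z \<and>
      dz (dx u) x y z = sep_xz x y z \<and> dy (dy u) x y z = sep_yy x y z \<and>
      dz (dy u) x y z = sep_yz x y z \<and> dz (dz u) x y z = sep_zz x y z"
proof -
  note D = has_gradient_on_simplexD
  have 0: "has_gradient_on_simplex u sep_x sep_y sep_z"
    by (rule has_gradient_on_simplex_cong[OF sep_gradient]) (simp_all add: u)
  have x: "has_gradient_on_simplex (dx u) sep_xx sep_xy sep_xz"
    by (rule has_gradient_on_simplex_cong[OF sep_second_gradients(1)]) (simp_all add: D(2)[OF 0])
  have y: "has_gradient_on_simplex (dy u) sep_xy sep_yy sep_yz"
    by (rule has_gradient_on_simplex_cong[OF sep_second_gradients(2)]) (simp_all add: D(3)[OF 0])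
  have z: "has_gradient_on_simplex (dz u) sep_xz sep_yz sep_zz"
    by (rule has_gradient_on_simplex_cong[OF sep_second_gradients(3)]) (simp_all add: D(4)[OF 0])
  show "has_second_partials_on u simplex3"
    using D(1)[OF 0] D(1)[OF x] D(1)[OF y] D(1)[OF z] by (simp add: has_second_partials_on_def)
  show "dx u x y z = sep_x x y z \<and> dy u x y z = sep_y x y z \<and> dz u x y z = sep_z x y z \<and>
      dx (dx u) x y z = sep_xx x y z \<and> dy (dx u) x y z = sep_xy x y z \<and>
      dz (dx u) x y z = sep_xz x y z \<and> dy (dy u) x y z = sep_yy x y z \<and>
      dz (dy u) x y z = sep_yz x y z \<and> dz (dz u) x y z = sep_zz x y z"
    if "(x, y, z) \<in> simplex3"
    using that D(2-4)[OF 0] D(2-4)[OF x] D(3,4)[OF y] D(4)[OF z] by simp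
qed

section \<open>From ordinary to partial differential equations\<close>

text \<open>
  With \<open>x\<close> and \<open>y\<close> fixed, \<open>z\<close> is a multiple of \<open>r\<close>, so this is the equation of \<open>h\<close>.
\<close>

lemma sep_pde_z:
  assumes S: "(x, y, z) \<in> simplex3" and ode: "jacobi_ode p q c 0 h"
  shows "z * (1 - x - y - z) * sep_zz x y z
      + ((q + 1) * (1 - x - y - z) - (p + 1) * z) * sep_z x y z + c * sep x y z = 0"
proof -
  from S obtain m n r where pos: "0 < m" "0 < n" and r: "0 < r" "r < 1"
    and coord: "1 - x = m" "m - y = m * n" "y / m = 1 - n" "z / (m * n) = r"
    and xyz: "x = 1 - m" "y = m * (1 - n)" "z = m * n * r"
    by (elim simplex3_coordinates)
  have "z * (1 - x - y - z) * sep_zz x y z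
      + ((q + 1) * (1 - x - y - z) - (p + 1) * z) * sep_z x y z + c * sep x y z
    = poly f x * poly g (1 - n) * (r * (1 - r) * poly (pderiv (pderiv h)) r
        + (q + 1 - (p + q + 2) * r) * poly (pderiv h) r + c * poly h r)"
    unfolding sep_defs Let_def coord unfolding xyz(3) using pos
    by (simp add: divide_simps power2_eq_square) (simp add: algebra_simps)
  with ode r show ?thesis by (simp add: jacobi_ode_def)
qed

text \<open>
  The field \<open>E = \<partial>\<^sub>y - z / (1 - x - y) * \<partial>\<^sub>z\<close> satisfies \<open>E x = E r = 0\<close> and
  \<open>E s = 1 / (1 - x)\<close>, so that \<open>(1 - x) * E\<close> acts as differentiation of \<open>g\<close>. As \<open>E\<close> kills its
  own coefficient, \<open>E (E u)\<close> is the displayed second order part divided by \<open>y * (1 - x - y)\<close>.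
\<close>

lemma sep_pde_y:
  assumes S: "(x, y, z) \<in> simplex3" and ode: "jacobi_ode p q c d g"
  shows "y * (1 - x - y) * sep_yy x y z - 2 * y * z * sep_yz x y z
      + y * z\<^sup>2 / (1 - x - y) * sep_zz x y z
      + ((q + 1) * (1 - x - y) - (p + 1) * y) * sep_y x y z
      + 1 / (1 - x - y) * ((p + 1) * y * z - (q + 1) * z * (1 - x - y)) * sep_z x y z
      + (c - d * y / (1 - x - y)) * sep x y z = 0" (is "?L = 0")
proof -
  from S obtain m n r where pos: "0 < m" "0 < n" and n: "n < 1"
    and coord: "1 - x = m" "m - y = m * n" "y / m = 1 - n" "z / (m * n) = r"
    and xyz: "x = 1 - m" "y = m * (1 - n)" "z = m * n * r"
    by (elim simplex3_coordinates)
  have "?L = poly f x * poly h r * ((1 - n) * n * poly (pderiv (pderiv g)) (1 - n)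
        + (q + 1 - (p + q + 2) * (1 - n)) * poly (pderiv g) (1 - n)
        + (c - d * (1 - n) / n) * poly g (1 - n))"
    unfolding sep_defs Let_def coord unfolding xyz(2,3) using pos
    by (simp add: divide_simps power2_eq_square) (simp add: algebra_simps)
  moreover have "(1 - n) * n * poly (pderiv (pderiv g)) (1 - n)
        + (q + 1 - (p + q + 2) * (1 - n)) * poly (pderiv g) (1 - n)
        + (c - d * (1 - n) / n) * poly g (1 - n) = 0"
    using ode[unfolded jacobi_ode_def, rule_format, of "1 - n"] pos n by simp
  ultimately show ?thesis by simp
qed

text \<open>
  The field \<open>\<partial>\<^sub>x - y / (1 - x) * \<partial>\<^sub>y - z / (1 - x) * \<partial>\<^sub>z\<close> kills \<open>s\<close>, \<open>r\<close> and its own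
  coefficients, and differentiates \<open>f\<close>. The zeroth order term is that of \<open>jacobi_ode\<close> by
  \<open>x / (1 - x) = 1 / (1 - x) - 1\<close>.
\<close>

lemma sep_pde_x:
  assumes S: "(x, y, z) \<in> simplex3" and ode: "jacobi_ode p q c d f"
  shows "x * (1 - x) * sep_xx x y z + x * y\<^sup>2 / (1 - x) * sep_yy x y z
      + x * z\<^sup>2 / (1 - x) * sep_zz x y z - 2 * x * y * sep_xy x y z
      - 2 * x * z * sep_xz x y z + 2 * x * y * z / (1 - x) * sep_yz x y z
      + (q + 1 - (p + q + 2) * x) * sep_x x y z
      - y / (1 - x) * (q + 1 - (p + q + 2) * x) * sep_y x y z
      - z / (1 - x) * (q + 1 - (p + q + 2) * x) * sep_z x y z
      + (c + d - d / (1 - x)) * sep x y z = 0" (is "?L = 0")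
proof -
  from S obtain m n r where pos: "0 < m" "0 < n"
    and coord: "1 - x = m" "m - y = m * n" "y / m = 1 - n" "z / (m * n) = r"
    and xyz: "x = 1 - m" "y = m * (1 - n)" "z = m * n * r"
    by (elim simplex3_coordinates)
  have "?L = poly g (1 - n) * poly h r * (x * (1 - x) * poly (pderiv (pderiv f)) x
        + (q + 1 - (p + q + 2) * x) * poly (pderiv f) x
        + (c - d * x / (1 - x)) * poly f x)"
    unfolding sep_defs Let_def coord unfolding xyz using pos
    by (simp add: divide_simps power2_eq_square) (simp add: algebra_simps)
  moreover have "0 < x" "x < 1" using S by (auto simp: simplex3_def)
  ultimately show ?thesis using ode by (simp add: jacobi_ode_def)
qed

end

section \<open>The six-parameter polynomials\<close>

text \<open>
  The shifts \<open>2 * n2 + 2 * n3\<close> and \<open>2 * n3\<close> in the first Jacobi parameters are those that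
  \<open>jacobi_ode_times_power\<close> removes when \<open>(1 - x) ^ (n2 + n3)\<close> and \<open>(1 - s) ^ n3\<close> are absorbed
  into \<open>f\<close> and \<open>g\<close>. What remains of them are the potentials \<open>D\<^sub>x\<close> and \<open>D\<^sub>y\<close> and a change of the
  constants.
\<close>

lemma simplex_jacobi_separated:
  fixes n1 n2 n3 :: nat and \<alpha> \<beta> \<gamma> \<delta> a b :: real
  defines "n \<equiv> real n1 + real n2 + real n3"
    and "D\<^sub>x \<equiv> (real n2 + real n3) * (real n2 + real n3 + \<beta> + \<gamma> + \<delta> + a + b + 2)"
    and "D\<^sub>y \<equiv> real n3 * (\<gamma> + \<delta> + b + real n3 + 1)"
  obtains f g h where
    "\<And>x y z. (x, y, z) \<in> simplex3 \<Longrightarrow>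
       simplex_jacobi n1 n2 n3 \<alpha> \<beta> \<gamma> \<delta> a b x y z = sep f g h x y z"
    "jacobi_ode (\<beta> + \<gamma> + \<delta> + a + b + 2) \<alpha>
       (n * (n + \<alpha> + \<beta> + \<gamma> + \<delta> + a + b + 3) - D\<^sub>x) D\<^sub>x f"
    "jacobi_ode (\<gamma> + \<delta> + b + 1) \<beta>
       ((\<beta> + 1) * real n3 + real n2 * (real n2 + 2 * real n3 + \<beta> + \<gamma> + \<delta> + b + 2)) D\<^sub>y g"
    "jacobi_ode \<delta> \<gamma> (real n3 * (real n3 + \<gamma> + \<delta> + 1)) 0 h"
proof -
  define N where "N = n2 + n3"
  let ?p = "\<beta> + \<gamma> + \<delta> + a + b + 2" and ?q = "\<gamma> + \<delta> + b + 1"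
  obtain F where F: "\<And>t. 0 < t \<Longrightarrow> t < 1 \<Longrightarrow>
      jacobi n1 (?p + 2 * real N) \<alpha> (2 * t - 1) = poly F t"
    and F_ode: "jacobi_ode (?p + 2 * real N) \<alpha> (real n1 * (real n1 + (?p + 2 * real N) + \<alpha> + 1)) 0 F"
    using jacobi_shifted_polynomial by blast
  obtain G where G: "\<And>t. 0 < t \<Longrightarrow> t < 1 \<Longrightarrow>
      jacobi n2 (?q + 2 * real n3) \<beta> (2 * t - 1) = poly G t"
    and G_ode: "jacobi_ode (?q + 2 * real n3) \<beta> (real n2 * (real n2 + (?q + 2 * real n3) + \<beta> + 1)) 0 G"
    using jacobi_shifted_polynomial by blast
  obtain h where h: "\<And>t. 0 < t \<Longrightarrow> t < 1 \<Longrightarrow> jacobi n3 \<delta> \<gamma> (2 * t - 1) = poly h t"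
    and h_ode: "jacobi_ode \<delta> \<gamma> (real n3 * (real n3 + \<delta> + \<gamma> + 1)) 0 h"
    using jacobi_shifted_polynomial by blast
  define f g where "f = [:1, -1:] ^ N * F" and "g = [:1, -1:] ^ n3 * G"
  show thesis
  proof (rule that)
    fix x y z assume S: "(x, y, z) \<in> simplex3"
    then have pos: "0 < x" "x < 1" "0 < y" "0 < z" "x + y < 1" "x + y + z < 1"
      by (auto simp: simplex3_def)
    have "jacobi n1 (\<beta> + \<gamma> + \<delta> + a + b + 2 * real n2 + 2 * real n3 + 2) \<alpha> (2 * x - 1) = poly F x"
      using F[of x] pos by (simp add: N_def algebra_simps)
    moreover have "jacobi n2 (\<gamma> + \<delta> + 2 * real n3 + b + 1) \<beta> (2 * y / (1 - x) - 1)
        = poly G (y / (1 - x))"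
      using G[of "y / (1 - x)"] pos by (simp add: algebra_simps)
    moreover have "jacobi n3 \<delta> \<gamma> (2 * z / (1 - x - y) - 1) = poly h (z / (1 - x - y))"
      using h[of "z / (1 - x - y)"] pos by simp
    moreover have "(1 - x) ^ n2 * (1 - x - y) ^ n3 = (1 - x) ^ N * (1 - y / (1 - x)) ^ n3"
    proof -
      have "1 - x - y = (1 - x) * (1 - y / (1 - x))" using pos by (simp add: field_simps)
      then show ?thesis by (simp only: N_def power_add power_mult_distrib mult.assoc)
    qed
    ultimately show "simplex_jacobi n1 n2 n3 \<alpha> \<beta> \<gamma> \<delta> a b x y z = sep f g h x y z"
      by (simp add: simplex_jacobi_def sep_def f_def g_def algebra_simps)
  next
    show "jacobi_ode ?p \<alpha> (n * (n + \<alpha> + \<beta> + \<gamma> + \<delta> + a + b + 3) - D\<^sub>x) D\<^sub>x f"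
      using jacobi_ode_times_power[OF F_ode]
      by (simp add: f_def N_def n_def D\<^sub>x_def algebra_simps)
    show "jacobi_ode ?q \<beta>
       ((\<beta> + 1) * real n3 + real n2 * (real n2 + 2 * real n3 + \<beta> + \<gamma> + \<delta> + b + 2)) D\<^sub>y g"
      using jacobi_ode_times_power[OF G_ode] by (simp add: g_def D\<^sub>y_def algebra_simps)
    show "jacobi_ode \<delta> \<gamma> (real n3 * (real n3 + \<gamma> + \<delta> + 1)) 0 h"
      using h_ode by (simp add: add_ac)
  qed
qed

theorem theorem2:
  fixes n1 n2 n3 n :: nat
    and \<alpha> \<beta> \<gamma> \<delta> a b :: real
    and u :: "real \<Rightarrow> real \<Rightarrow> real \<Rightarrow> real"
  assumes n: "n = n1 + n2 + n3"
    and u: "u = simplex_jacobi n1 n2 n3 \<alpha> \<beta> \<gamma> \<delta> a b"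
  shows "has_second_partials_on u simplex3 \<and>
    (\<forall>(x, y, z) \<in> simplex3.
      x * (1 - x) * dx (dx u) x y z + y * (1 - y) * dy (dy u) x y z
      + z * (1 - z) * dz (dz u) x y z - 2 * x * z * dz (dx u) x y z
      - 2 * y * z * dz (dy u) x y z - 2 * x * y * dy (dx u) x y z
      + (\<alpha> + 1 - (\<alpha> + \<beta> + \<gamma> + \<delta> + a + b + 4) * x) * dx u x y z
      + (\<beta> + 1 - (\<alpha> + \<beta> + \<gamma> + \<delta> + 4) * y + ((a + b) * x * y - b * y) / (1 - x)) * dy u x y z
      + (\<gamma> + 1 - (\<alpha> + \<beta> + \<gamma> + \<delta> + 4) * z + (a + b) * x * z / (1 - x)
          + b * y * z / ((1 - x) * (1 - x - y))) * dz u x y z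
      + (real n * (real n + \<alpha> + \<beta> + \<gamma> + \<delta> + a + b + 3)
          - a * (real n2 + real n3) / (1 - x) - real n3 * b / (1 - x - y)) * u x y z = 0) \<and>
    (\<forall>(x, y, z) \<in> simplex3.
      y * (1 - x - y) * dy (dy u) x y z - 2 * y * z * dz (dy u) x y z
      + y * z\<^sup>2 / (1 - x - y) * dz (dz u) x y z
      + ((\<beta> + 1) * (1 - x - y) - (\<gamma> + \<delta> + b + 2) * y) * dy u x y z
      + 1 / (1 - x - y) * ((\<gamma> + \<delta> + b + 2) * y * z - (\<beta> + 1) * z * (1 - x - y)) * dz u x y z
      + ((\<beta> + 1) * real n3 + real n2 * (real n2 + 2 * real n3 + \<beta> + \<gamma> + \<delta> + b + 2)
          - real n3 * (\<gamma> + \<delta> + b + real n3 + 1) * y / (1 - x - y)) * u x y z = 0) \<and>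
    (\<forall>(x, y, z) \<in> simplex3.
      z * (1 - x - y - z) * dz (dz u) x y z
      + ((\<gamma> + 1) * (1 - x - y - z) - (\<delta> + 1) * z) * dz u x y z
      + real n3 * (real n3 + \<gamma> + \<delta> + 1) * u x y z = 0) \<and>
    (\<forall>(x, y, z) \<in> simplex3.
      x * (1 - x) * dx (dx u) x y z + x * y\<^sup>2 / (1 - x) * dy (dy u) x y z
      + x * z\<^sup>2 / (1 - x) * dz (dz u) x y z - 2 * x * y * dy (dx u) x y z
      - 2 * x * z * dz (dx u) x y z + 2 * x * y * z / (1 - x) * dz (dy u) x y z
      + (\<alpha> + 1 - (\<alpha> + \<beta> + \<gamma> + \<delta> + a + b + 4) * x) * dx u x y z
      - y / (1 - x) * (\<alpha> + 1 - (\<alpha> + \<beta> + \<gamma> + \<delta> + a + b + 4) * x) * dy u x y z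
      - z / (1 - x) * (\<alpha> + 1 - (\<alpha> + \<beta> + \<gamma> + \<delta> + a + b + 4) * x) * dz u x y z
      + (real n * (real n + \<alpha> + \<beta> + \<gamma> + \<delta> + a + b + 3)
          - (real n2 + real n3) * (real n2 + real n3 + \<beta> + \<gamma> + \<delta> + a + b + 2) / (1 - x)) * u x y z = 0)"
proof -
  obtain f g h where u_sep: "\<forall>x y z. (x, y, z) \<in> simplex3 \<longrightarrow> u x y z = sep f g h x y z"
    and f: "jacobi_ode (\<beta> + \<gamma> + \<delta> + a + b + 2) \<alpha>
       (real n * (real n + \<alpha> + \<beta> + \<gamma> + \<delta> + a + b + 3)
          - (real n2 + real n3) * (real n2 + real n3 + \<beta> + \<gamma> + \<delta> + a + b + 2))
       ((real n2 + real n3) * (real n2 + real n3 + \<beta> + \<gamma> + \<delta> + a + b + 2)) f"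
    and g: "jacobi_ode (\<gamma> + \<delta> + b + 1) \<beta>
       ((\<beta> + 1) * real n3 + real n2 * (real n2 + 2 * real n3 + \<beta> + \<gamma> + \<delta> + b + 2))
       (real n3 * (\<gamma> + \<delta> + b + real n3 + 1)) g"
    and h: "jacobi_ode \<delta> \<gamma> (real n3 * (real n3 + \<gamma> + \<delta> + 1)) 0 h"
    using simplex_jacobi_separated[of n1 n2 n3 \<alpha> \<beta> \<gamma> \<delta> a b] unfolding u n of_nat_add by metis
  note partials = u_sep[rule_format] sep_partials(2)[OF u_sep]
  have pde2: "y * (1 - x - y) * dy (dy u) x y z - 2 * y * z * dz (dy u) x y z
      + y * z\<^sup>2 / (1 - x - y) * dz (dz u) x y z
      + ((\<beta> + 1) * (1 - x - y) - (\<gamma> + \<delta> + b + 2) * y) * dy u x y z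
      + 1 / (1 - x - y) * ((\<gamma> + \<delta> + b + 2) * y * z - (\<beta> + 1) * z * (1 - x - y)) * dz u x y z
      + ((\<beta> + 1) * real n3 + real n2 * (real n2 + 2 * real n3 + \<beta> + \<gamma> + \<delta> + b + 2)
          - real n3 * (\<gamma> + \<delta> + b + real n3 + 1) * y / (1 - x - y)) * u x y z = 0"
    if S: "(x, y, z) \<in> simplex3" for x y z
    using sep_pde_y[OF S g, of f h] by (simp add: partials[OF S] add.assoc)
  have pde3: "z * (1 - x - y - z) * dz (dz u) x y z
      + ((\<gamma> + 1) * (1 - x - y - z) - (\<delta> + 1) * z) * dz u x y z
      + real n3 * (real n3 + \<gamma> + \<delta> + 1) * u x y z = 0"
    if S: "(x, y, z) \<in> simplex3" for x y z
    using sep_pde_z[OF S h, of f g] by (simp add: partials[OF S])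
  have pde4: "x * (1 - x) * dx (dx u) x y z + x * y\<^sup>2 / (1 - x) * dy (dy u) x y z
      + x * z\<^sup>2 / (1 - x) * dz (dz u) x y z - 2 * x * y * dy (dx u) x y z
      - 2 * x * z * dz (dx u) x y z + 2 * x * y * z / (1 - x) * dz (dy u) x y z
      + (\<alpha> + 1 - (\<alpha> + \<beta> + \<gamma> + \<delta> + a + b + 4) * x) * dx u x y z
      - y / (1 - x) * (\<alpha> + 1 - (\<alpha> + \<beta> + \<gamma> + \<delta> + a + b + 4) * x) * dy u x y z
      - z / (1 - x) * (\<alpha> + 1 - (\<alpha> + \<beta> + \<gamma> + \<delta> + a + b + 4) * x) * dz u x y z
      + (real n * (real n + \<alpha> + \<beta> + \<gamma> + \<delta> + a + b + 3)
          - (real n2 + real n3) * (real n2 + real n3 + \<beta> + \<gamma> + \<delta> + a + b + 2) / (1 - x)) * u x y z = 0"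
    if S: "(x, y, z) \<in> simplex3" for x y z
  proof -
    have c: "\<beta> + \<gamma> + \<delta> + a + b + 2 + \<alpha> + 2 = \<alpha> + \<beta> + \<gamma> + \<delta> + a + b + 4" by simp
    show ?thesis
      using sep_pde_x[OF S f, of g h, unfolded c] by (simp add: partials[OF S])
  qed
  have pde1: "x * (1 - x) * dx (dx u) x y z + y * (1 - y) * dy (dy u) x y z
      + z * (1 - z) * dz (dz u) x y z - 2 * x * z * dz (dx u) x y z
      - 2 * y * z * dz (dy u) x y z - 2 * x * y * dy (dx u) x y z
      + (\<alpha> + 1 - (\<alpha> + \<beta> + \<gamma> + \<delta> + a + b + 4) * x) * dx u x y z
      + (\<beta> + 1 - (\<alpha> + \<beta> + \<gamma> + \<delta> + 4) * y + ((a + b) * x * y - b * y) / (1 - x)) * dy u x y z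
      + (\<gamma> + 1 - (\<alpha> + \<beta> + \<gamma> + \<delta> + 4) * z + (a + b) * x * z / (1 - x)
          + b * y * z / ((1 - x) * (1 - x - y))) * dz u x y z
      + (real n * (real n + \<alpha> + \<beta> + \<gamma> + \<delta> + a + b + 3)
          - a * (real n2 + real n3) / (1 - x) - real n3 * b / (1 - x - y)) * u x y z = 0" (is "?L = 0")
    if S: "(x, y, z) \<in> simplex3" for x y z
  proof -
    have nz: "1 - x \<noteq> 0" "1 - x - y \<noteq> 0" using S by (auto simp: simplex3_def)
    \<comment> \<open>The multipliers are forced by the \<open>u\<^sub>y\<^sub>y\<close> and \<open>u\<^sub>z\<^sub>z\<close> terms.\<close>
    have "?L = (x * (1 - x) * dx (dx u) x y z + x * y\<^sup>2 / (1 - x) * dy (dy u) x y z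
      + x * z\<^sup>2 / (1 - x) * dz (dz u) x y z - 2 * x * y * dy (dx u) x y z
      - 2 * x * z * dz (dx u) x y z + 2 * x * y * z / (1 - x) * dz (dy u) x y z
      + (\<alpha> + 1 - (\<alpha> + \<beta> + \<gamma> + \<delta> + a + b + 4) * x) * dx u x y z
      - y / (1 - x) * (\<alpha> + 1 - (\<alpha> + \<beta> + \<gamma> + \<delta> + a + b + 4) * x) * dy u x y z
      - z / (1 - x) * (\<alpha> + 1 - (\<alpha> + \<beta> + \<gamma> + \<delta> + a + b + 4) * x) * dz u x y z
      + (real n * (real n + \<alpha> + \<beta> + \<gamma> + \<delta> + a + b + 3)
          - (real n2 + real n3) * (real n2 + real n3 + \<beta> + \<gamma> + \<delta> + a + b + 2) / (1 - x)) * u x y z)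
      + (y * (1 - x - y) * dy (dy u) x y z - 2 * y * z * dz (dy u) x y z
      + y * z\<^sup>2 / (1 - x - y) * dz (dz u) x y z
      + ((\<beta> + 1) * (1 - x - y) - (\<gamma> + \<delta> + b + 2) * y) * dy u x y z
      + 1 / (1 - x - y) * ((\<gamma> + \<delta> + b + 2) * y * z - (\<beta> + 1) * z * (1 - x - y)) * dz u x y z
      + ((\<beta> + 1) * real n3 + real n2 * (real n2 + 2 * real n3 + \<beta> + \<gamma> + \<delta> + b + 2)
          - real n3 * (\<gamma> + \<delta> + b + real n3 + 1) * y / (1 - x - y)) * u x y z) / (1 - x)
      + (z * (1 - x - y - z) * dz (dz u) x y z
      + ((\<gamma> + 1) * (1 - x - y - z) - (\<delta> + 1) * z) * dz u x y z
      + real n3 * (real n3 + \<gamma> + \<delta> + 1) * u x y z) / (1 - x - y)"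
      using nz by (simp add: divide_simps power2_eq_square) (simp add: algebra_simps)
    then show ?thesis unfolding pde2[OF S] pde3[OF S] pde4[OF S] by simp
  qed
  show ?thesis
    using sep_partials(1)[OF u_sep] pde1 pde2 pde3 pde4 by blast
qed

end
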